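(* Assume the 3x+1 conjecture holds (every positive integer reaches $1$ under iteration of the Collatz function $C$), and assume the Weak Residue Conjecture holds, i.e. $\mathrm{Res}(N)<2$ for every positive integer $N$. Then for every positive integer $N$ the following six identities hold (so that, given $N$, any one of $D(N),O(N),E(N)$ determines the other two): $$\begin{aligned} O(N)&=\lfloor (\log_6 2)\, D(N)-\log_6 N\rfloor,\\ E(N)&=\lceil (\log_6 3)\, D(N)+\log_6 N\rceil,\\ D(N)&=\lceil (\log_2 6)\, O(N)+\log_2 N\rceil,\\ E(N)&=\lceil (\log_2 3)\, O(N)+\log_2 N\rceil,\\ D(N)&=\lfloor (\log_3 6)\, E(N)-\log_3 N\rfloor,\\ O(N)&=\lfloor (\log_3 2)\, E(N)-\log_3 N\rfloor. \end{aligned}$$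
   Context: The Collatz function on positive integers is $C(N)=3N+1$ if $N$ is odd and $C(N)=N/2$ if $N$ is even. For a positive integer $N$ whose iterates under $C$ reach $1$, iterate $C$ from $N$ until $1$ is reached for the first time (zero steps if $N=1$). $D(N)$ is the total number of steps performed, $O(N)$ is the number of odd steps (steps applying $C$ to an odd integer), and $E(N)$ is the number of even steps (steps applying $C$ to an even integer); thus $D(N)=O(N)+E(N)$. The Residue of $N$ is $\mathrm{Res}(N)=\dfrac{2^{E(N)}}{3^{O(N)}\cdot N}$. *)

theory Defs
  imports Complex_Main
begin

text \<open>The value at the non-positive input 0 is irrelevant: all statements below are
  restricted to positive integers, and \<open>collatz\<close> maps positive integers to positive integers.\<close>

definition collatz :: "nat \<Rightarrow> nat" where
  "collatz n = (if odd n then 3 * n + 1 else n div 2)"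

definition collatz_conjecture :: bool where
  "collatz_conjecture \<longleftrightarrow> (\<forall>N>0. \<exists>k. (collatz ^^ k) N = 1)"

text \<open>The three counting functions below are meaningful only for \<open>N\<close> whose iterates reach 1.
  The integer to which step number \<open>i\<close> (counted from 0) applies \<open>collatz\<close> is
  \<open>(collatz ^^ i) N\<close>.\<close>

definition total_steps :: "nat \<Rightarrow> nat" where
  "total_steps N = (LEAST k. (collatz ^^ k) N = 1)"

definition odd_steps :: "nat \<Rightarrow> nat" where
  "odd_steps N = card {i. i < total_steps N \<and> odd ((collatz ^^ i) N)}"

definition even_steps :: "nat \<Rightarrow> nat" where
  "even_steps N = card {i. i < total_steps N \<and> even ((collatz ^^ i) N)}"

definition Res :: "nat \<Rightarrow> real" where
  "Res N = 2 ^ even_steps N / (3 ^ odd_steps N * real N)"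

definition weak_residue_conjecture :: bool where
  "weak_residue_conjecture \<longleftrightarrow> (\<forall>N>0. Res N < 2)"

end

theory Submission
  imports Defs
begin

text \<open>
  An even step contributes exactly a factor \<open>1/2\<close> and an odd step at least a factor \<open>3\<close>, so
  \<open>1 = 3^O N / 2^E\<close> up to the product of the factors \<open>1 + 1/(3m)\<close> lost at the odd steps;
  that product is the residue, hence \<open>1 \<le> Res N\<close>.
  With \<open>r = ln (Res N)\<close> this reads \<open>E ln 2 = O ln 3 + ln N + r\<close>, where \<open>0 \<le> r < ln 2\<close>.
  Each of the six real expressions differs from the claimed integer by \<open>r\<close> divided by
  \<open>ln 2\<close>, \<open>ln 3\<close> or \<open>ln 6\<close>, which lies in \<open>[0, 1)\<close>.
\<close>

lemma card_Collect_less_Suc: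
  "card {i. i < Suc k \<and> P i} = card {i. i < k \<and> P i} + (if P k then 1 else 0)"
proof -
  have "{i. i < Suc k \<and> P i} = (if P k then insert k {i. i < k \<and> P i} else {i. i < k \<and> P i})"
    by (auto simp: less_Suc_eq)
  then show ?thesis by simp
qed

text \<open>Induction on \<open>k\<close>: an even step trades a factor 2 of the iterate for one
  more power of 2, so nothing is lost; an odd step loses only the \<open>+ 1\<close> in
  \<open>3 * m + 1\<close>. Multiplying out the denominators keeps the argument in
  \<open>nat\<close>.\<close>

lemma pow3_le_pow2_mult_collatz_funpow:
  "3 ^ card {i. i < k \<and> odd ((collatz ^^ i) N)} * N
    \<le> 2 ^ card {i. i < k \<and> even ((collatz ^^ i) N)} * (collatz ^^ k) N"
proof (induction k)
  case 0
  then show ?case by simp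
next
  case (Suc k)
  define m where "m = (collatz ^^ k) N"
  define e where "e = card {i. i < k \<and> even ((collatz ^^ i) N)}"
  show ?case
  proof (cases "even m")
    case True
    then have "m = 2 * collatz m"
      by (simp add: collatz_def)
    then have "2 ^ e * m = 2 ^ Suc e * collatz m"
      by (metis mult.assoc power_Suc2)
    with Suc have "3 ^ card {i. i < k \<and> odd ((collatz ^^ i) N)} * N \<le> 2 ^ Suc e * collatz m"
      by (simp only: m_def e_def)
    then show ?thesis
      using True unfolding card_Collect_less_Suc by (simp add: m_def e_def)
  next
    case False
    have "2 ^ e * (3 * m) \<le> 2 ^ e * collatz m"
      using False by (intro mult_left_mono) (simp_all add: collatz_def)
    moreover have "3 ^ card {i. i < k \<and> odd ((collatz ^^ i) N)} * N \<le> 2 ^ e * m"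
      using Suc by (simp only: m_def e_def)
    ultimately have "3 * (3 ^ card {i. i < k \<and> odd ((collatz ^^ i) N)} * N) \<le> 2 ^ e * collatz m"
      by linarith
    then show ?thesis
      using False unfolding card_Collect_less_Suc by (simp add: m_def e_def mult.assoc)
  qed
qed

lemma odd_steps_add_even_steps: "odd_steps N + even_steps N = total_steps N"
proof -
  have "odd_steps N + even_steps N = card ({i. i < total_steps N \<and> odd ((collatz ^^ i) N)}
      \<union> {i. i < total_steps N \<and> even ((collatz ^^ i) N)})"
    unfolding odd_steps_def even_steps_def by (rule card_Un_disjoint[symmetric]) auto
  also have "\<dots> = card {..<total_steps N}"
    by (rule arg_cong[of _ _ card]) auto
  finally show ?thesis by simp
qed

lemma one_le_Res:
  assumes "N > 0" "\<exists>k. (collatz ^^ k) N = 1"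
  shows "1 \<le> Res N"
proof -
  have "(collatz ^^ total_steps N) N = 1"
    unfolding total_steps_def using assms(2) by (rule LeastI_ex)
  then have "3 ^ odd_steps N * N \<le> 2 ^ even_steps N"
    using pow3_le_pow2_mult_collatz_funpow[of "total_steps N" N]
    by (simp add: odd_steps_def even_steps_def)
  then have "real (3 ^ odd_steps N * N) \<le> real (2 ^ even_steps N)"
    by (rule of_nat_mono)
  then show ?thesis
    using assms(1) by (simp add: Res_def)
qed

lemma ln_Res:
  assumes "N > 0"
  shows "ln (Res N) = real (even_steps N) * ln 2 - (real (odd_steps N) * ln 3 + ln (real N))"
  using assms by (simp add: Res_def ln_div ln_mult ln_realpow)

text \<open>Intended for \<open>r = ln (Res N)\<close> and \<open>c\<close> one of
  \<open>ln 2\<close>, \<open>ln 3\<close>, \<open>ln 6\<close>, the logarithm of the base in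
  question. The bounds on \<open>r\<close> force \<open>c > 0\<close>.\<close>

lemma int_eq_floor_of_add:
  fixes n :: nat and r c x :: real
  assumes "0 \<le> r" "r < c" "x = real n + r / c"
  shows "int n = \<lfloor>x\<rfloor>"
proof -
  have "0 \<le> r / c" "r / c < 1"
    using assms by (simp_all add: divide_simps)
  then show ?thesis using assms(3) by linarith
qed

lemma int_eq_ceiling_of_diff:
  fixes n :: nat and r c x :: real
  assumes "0 \<le> r" "r < c" "x = real n - r / c"
  shows "int n = \<lceil>x\<rceil>"
proof -
  have "0 \<le> r / c" "r / c < 1"
    using assms by (simp_all add: divide_simps)
  then show ?thesis using assms(3) by linarith
qed

theorem theorem4p1:
  fixes N :: nat
  assumes "collatz_conjecture"
    and "weak_residue_conjecture"
    and "N > 0"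
  shows "int (odd_steps N) = \<lfloor>log 6 2 * real (total_steps N) - log 6 (real N)\<rfloor>
    \<and> int (even_steps N) = \<lceil>log 6 3 * real (total_steps N) + log 6 (real N)\<rceil>
    \<and> int (total_steps N) = \<lceil>log 2 6 * real (odd_steps N) + log 2 (real N)\<rceil>
    \<and> int (even_steps N) = \<lceil>log 2 3 * real (odd_steps N) + log 2 (real N)\<rceil>
    \<and> int (total_steps N) = \<lfloor>log 3 6 * real (even_steps N) - log 3 (real N)\<rfloor>
    \<and> int (odd_steps N) = \<lfloor>log 3 2 * real (even_steps N) - log 3 (real N)\<rfloor>"
proof -
  define r where "r = ln (Res N)"
  have "1 \<le> Res N" "Res N < 2"
    using assms one_le_Res by (auto simp: collatz_conjecture_def weak_residue_conjecture_def)
  then have r: "0 \<le> r" "r < ln 2"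
    by (simp_all add: r_def)
  have ln6: "ln 6 = ln 2 + ln (3 :: real)"
    using ln_mult_pos[of 2 "3 :: real"] by simp
  have pos: "0 < ln (2 :: real)" "0 < ln (3 :: real)"
    by simp_all
  \<comment> \<open>The bound by \<open>ln 2\<close> is the tightest of the three, since
    \<open>ln 2 < ln 3 < ln 6\<close>.\<close>
  have r3: "r < ln 3" and r6: "r < ln 6"
    using r ln6 pos ln_less_cancel_iff[of 2 "3 :: real"] by linarith+
  have D: "real (total_steps N) = real (odd_steps N) + real (even_steps N)"
    by (simp flip: odd_steps_add_even_steps)
  have lnN: "ln (real N) = real (even_steps N) * ln 2 - real (odd_steps N) * ln 3 - r"
    using ln_Res[OF assms(3)] by (simp add: r_def)
  \<comment> \<open>Clear the denominator \<open>ln 6\<close> and eliminate \<open>ln N\<close>.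
    With \<open>D = O + E\<close>, the terms \<open>E ln 2\<close> cancel and leave
    \<open>D ln 2 - ln N = O ln 6 + r\<close>; likewise \<open>D ln 3 + ln N = E ln 6 - r\<close>.
    The sign of \<open>r\<close> decides between floor and ceiling.\<close>
  have "log 6 2 * real (total_steps N) - log 6 (real N) = real (odd_steps N) + r / ln 6"
    "log 6 3 * real (total_steps N) + log 6 (real N) = real (even_steps N) - r / ln 6"
    using r6 r(1) by (simp_all add: log_def divide_simps) (simp_all add: lnN D ln6 algebra_simps)
  note log6 = this
  have "log 2 6 * real (odd_steps N) + log 2 (real N) = real (total_steps N) - r / ln 2"
    "log 2 3 * real (odd_steps N) + log 2 (real N) = real (even_steps N) - r / ln 2"
    using pos by (simp_all add: log_def divide_simps) (simp_all add: lnN D ln6 algebra_simps)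
  note log2 = this
  \<comment> \<open>Here the terms \<open>E ln 2\<close> cancel again:
    \<open>E ln 6 - ln N = D ln 3 + r\<close>.\<close>
  have "log 3 6 * real (even_steps N) - log 3 (real N) = real (total_steps N) + r / ln 3"
    "log 3 2 * real (even_steps N) - log 3 (real N) = real (odd_steps N) + r / ln 3"
    using pos by (simp_all add: log_def divide_simps) (simp_all add: lnN D ln6 algebra_simps)
  note log3 = this
  show ?thesis
    using int_eq_floor_of_add[OF r(1) r6 log6(1)] int_eq_ceiling_of_diff[OF r(1) r6 log6(2)]
      int_eq_ceiling_of_diff[OF r log2(1)] int_eq_ceiling_of_diff[OF r log2(2)]
      int_eq_floor_of_add[OF r(1) r3 log3(1)] int_eq_floor_of_add[OF r(1) r3 log3(2)]
    by (intro conjI)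
qed

end
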